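(* Let $\varphi:\mathbb{N}\to\mathbb{N}$ be a map, let $w=(w_n)_{n\in\mathbb{N}}$ be a sequence of scalars, and let $wC_\varphi$ be an unbounded weighted pseudo-shift operator on $c_0$. Then $wC_\varphi$ is chaotic if and only if the following assertions hold: (1) $\varphi$ is injective. (2) $\varphi^n$ has no fixed point for any $n\in\mathbb{N}$. (3) For each $k\in\mathbb{N}$, $$\lim_{n\to\infty}\left|w_k w_{\varphi(k)}\cdots w_{\varphi^{n-1}(k)}\right|=\infty$$ and $$\lim_{n\to\infty}\left|w_{\varphi^{-1}(k)}w_{\varphi^{-2}(k)}\cdots w_{\varphi^{-n}(k)}\right|=0.$$
   Context: $\mathbb{N}=\{1,2,3,\dots\}$; $\mathbb{K}=\mathbb{R}$ or $\mathbb{C}$ is the scalar field; $c_0$ is the Banach space of null sequences $(x_k)_{k\in\mathbb{N}}$ in $\mathbb{K}$ with the sup norm; $e_k$ ($k\in\mathbb{N}$) is the $k$-th canonical unit sequence; $\varphi^n$ is the $n$-fold iterate of $\varphi$. Weighted pseudo-shift on $c_0$: for $\varphi:\mathbb{N}\to\mathbb{N}$ and an arbitrary scalar sequence $(w_k)_{k\in\mathbb{N}}$, $wC_\varphi\big(\sum_{k}x_ke_k\big)=\sum_{k}w_kx_{\varphi(k)}e_k$ with domain $D(wC_\varphi)=\{x\in c_0: (w_kx_{\varphi(k)})_k\in c_0\}$. It is called unbounded when it is not a bounded linear operator defined on all of $c_0$ (for injective $\varphi$ this means $\sup_{n}|w_n|=\infty$). Its powers are $(wC_\varphi)^n\big(\sum_k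 x_ke_k\big)=\sum_k w_kw_{\varphi(k)}\cdots w_{\varphi^{n-1}(k)}x_{\varphi^n(k)}e_k$ with domain $D((wC_\varphi)^n)=\{x\in c_0:(w_kw_{\varphi(k)}\cdots w_{\varphi^{n-1}(k)}x_{\varphi^n(k)})_k\in c_0\}$, for $n\in\mathbb{N}$, and $D((wC_\varphi)^\infty)=\bigcap_{n\ge1}D((wC_\varphi)^n)$. A densely defined (possibly unbounded) operator $T$ on a separable infinite-dimensional Banach space $X$ is hypercyclic if there is $f\in D(T^\infty)=\bigcap_{n\ge1}D(T^n)$ whose orbit $\{f,Tf,T^2f,\dots\}$ is dense in $X$. A vector $f$ is periodic for $T$ if there is $n\in\mathbb{N}$ with $f\in D(T^n)$ and $T^nf=f$. $T$ is chaotic if it is hypercyclic and its set of periodic points is dense in $X$. Negative iterates (for $\varphi$ injective): for $n,k\in\mathbb{N}$, $\varphi^{-n}(k)=l$ if there is $l\in\mathbb{N}$ with $\varphi^n(l)=k$, and $\varphi^{-n}(k)=0$ if there is no such $l$. Convention: $w_0=0$.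
   Formalization: For periodic points, the domain of the n-th power is the natural composition domain (the coordinate formulas of all orders 1 to n must lie in c_0), not only the n-th formula as displayed; with the displayed domain the equivalence fails. *)

theory Defs
  imports "HOL-Analysis.Analysis"
begin

text \<open>
  Sequences are indexed by \<open>{1, 2, \<dots>}\<close>; they are functions on \<^typ>\<open>nat\<close> that vanish at the spare
  index 0. The scalar field is a type of sort \<open>{real_normed_field, euclidean_space}\<close>:
  both \<^typ>\<open>real\<close> and \<^typ>\<open>complex\<close> belong to it, and they are its only instances up to isomorphism.
\<close>

definition null_seqs :: "(nat \<Rightarrow> 'a::real_normed_vector) set" where
  "null_seqs = {x. x 0 = 0 \<and> x \<longlonglongrightarrow> 0}"

typedef (overloaded) 'a c0 = "null_seqs :: (nat \<Rightarrow> 'a::real_normed_vector) set"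
  morphisms coord Abs_c0
  by (rule exI[of _ "\<lambda>_. 0"]) (simp add: null_seqs_def)

lemma coord_0 [simp]: "coord x 0 = 0"
  using coord[of x] by (simp add: null_seqs_def)

lemma coord_tendsto_0: "coord x \<longlonglongrightarrow> 0"
  using coord[of x] by (simp add: null_seqs_def)

lemma c0_eqI: "(\<And>k. coord x k = coord y k) \<Longrightarrow> x = y"
  by (metis coord_inject ext)

instantiation c0 :: (real_normed_vector) real_vector
begin

definition zero_c0 :: "'a c0" where "0 = Abs_c0 (\<lambda>_. 0)"
definition plus_c0 :: "'a c0 \<Rightarrow> 'a c0 \<Rightarrow> 'a c0" where "x + y = Abs_c0 (\<lambda>k. coord x k + coord y k)"
definition minus_c0 :: "'a c0 \<Rightarrow> 'a c0 \<Rightarrow> 'a c0" where "x - y = Abs_c0 (\<lambda>k. coord x k - coord y k)"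
definition uminus_c0 :: "'a c0 \<Rightarrow> 'a c0" where "- x = Abs_c0 (\<lambda>k. - coord x k)"
definition scaleR_c0 :: "real \<Rightarrow> 'a c0 \<Rightarrow> 'a c0" where "r *\<^sub>R x = Abs_c0 (\<lambda>k. r *\<^sub>R coord x k)"

lemma coord_zero [simp]: "coord 0 k = (0 :: 'a)"
  unfolding zero_c0_def by (subst Abs_c0_inverse) (auto simp: null_seqs_def)

lemma coord_plus [simp]: "coord (x + y) k = coord x k + coord y k" for x y :: "'a c0"
  unfolding plus_c0_def
  by (subst Abs_c0_inverse) (use tendsto_add[OF coord_tendsto_0[of x] coord_tendsto_0[of y]] in
      \<open>auto simp: null_seqs_def\<close>)

lemma coord_minus [simp]: "coord (x - y) k = coord x k - coord y k" for x y :: "'a c0"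
  unfolding minus_c0_def
  by (subst Abs_c0_inverse) (use tendsto_diff[OF coord_tendsto_0[of x] coord_tendsto_0[of y]] in
      \<open>auto simp: null_seqs_def\<close>)

lemma coord_uminus [simp]: "coord (- x) k = - coord x k" for x :: "'a c0"
  unfolding uminus_c0_def
  by (subst Abs_c0_inverse) (use tendsto_minus[OF coord_tendsto_0[of x]] in
      \<open>auto simp: null_seqs_def\<close>)

lemma coord_scaleR [simp]: "coord (r *\<^sub>R x) k = r *\<^sub>R coord x k" for x :: "'a c0"
  unfolding scaleR_c0_def
  by (subst Abs_c0_inverse) (use tendsto_scaleR[OF tendsto_const[of r] coord_tendsto_0[of x]] in
      \<open>auto simp: null_seqs_def\<close>)

instance
  by standard (auto simp: algebra_simps intro!: c0_eqI)

end

instantiation c0 :: (real_normed_vector) real_normed_vector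
begin

definition norm_c0 :: "'a c0 \<Rightarrow> real" where "norm x = (SUP k. norm (coord x k))"
definition sgn_c0 :: "'a c0 \<Rightarrow> 'a c0" where "sgn_c0 x = x /\<^sub>R norm x"
definition dist_c0 :: "'a c0 \<Rightarrow> 'a c0 \<Rightarrow> real" where "dist_c0 x y = norm (x - y)"
definition uniformity_c0 :: "('a c0 \<times> 'a c0) filter" where
  "uniformity_c0 = (INF e\<in>{0<..}. principal {(x, y). dist x y < e})"
definition open_c0 :: "'a c0 set \<Rightarrow> bool" where
  "open_c0 U \<longleftrightarrow> (\<forall>x\<in>U. eventually (\<lambda>(x', y). x' = x \<longrightarrow> y \<in> U) uniformity)"

lemma bdd_above_coord: "bdd_above (range (\<lambda>k. norm (coord x k)))" for x :: "'a c0"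
proof -
  have "Bseq (coord x)"
    using coord_tendsto_0 by (blast intro: convergent_imp_Bseq convergentI)
  then show ?thesis
    by (auto simp: Bseq_def bdd_above_def)
qed

lemma norm_coord_le: "norm (coord x k) \<le> norm x" for x :: "'a c0"
  unfolding norm_c0_def by (rule cSUP_upper[OF _ bdd_above_coord]) simp

lemma norm_c0_le: "norm x \<le> b" if "\<And>k. norm (coord x k) \<le> b" for x :: "'a c0"
  unfolding norm_c0_def by (rule cSUP_least) (use that in auto)

instance
proof
  fix x y :: "'a c0" and a b :: real
  show "norm x = 0 \<longleftrightarrow> x = 0"
  proof
    assume "norm x = 0"
    then show "x = 0"
      using norm_coord_le[of x] by (intro c0_eqI) simp
  next
    assume "x = 0"
    then show "norm x = 0"
      by (simp add: norm_c0_def)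
  qed
  show "norm (x + y) \<le> norm x + norm y"
    by (rule norm_c0_le)
      (metis add_mono coord_plus norm_coord_le norm_triangle_le)
  show "norm (a *\<^sub>R x) = \<bar>a\<bar> * norm x"
  proof (rule antisym)
    show "norm (a *\<^sub>R x) \<le> \<bar>a\<bar> * norm x"
      by (rule norm_c0_le) (simp add: mult_left_mono norm_coord_le)
    show "\<bar>a\<bar> * norm x \<le> norm (a *\<^sub>R x)"
    proof (cases "a = 0")
      case True
      then show ?thesis
        using order_trans[OF norm_ge_zero norm_coord_le[of "a *\<^sub>R x" 0]] by simp
    next
      case False
      have "norm x \<le> norm (a *\<^sub>R x) / \<bar>a\<bar>"
        by (rule norm_c0_le)
          (use norm_coord_le[of "a *\<^sub>R x"] False in \<open>simp add: field_simps\<close>)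
      then show ?thesis
        using False by (simp add: field_simps)
    qed
  qed
qed (auto simp: sgn_c0_def dist_c0_def uniformity_c0_def open_c0_def)

end

instance c0 :: (banach) banach
proof
  fix X :: "nat \<Rightarrow> 'a c0"
  assume X: "Cauchy X"
  have coord_le: "dist (coord x k) (coord y k) \<le> dist x y" for x y :: "'a c0" and k
    using norm_coord_le[of "x - y" k] by (simp add: dist_norm)
  have unif: "uniformly_Cauchy_on UNIV (\<lambda>n k. coord (X n) k)"
    unfolding uniformly_Cauchy_on_def
    using X coord_le by (meson Cauchy_def order_le_less_trans)
  then obtain l where l: "uniform_limit UNIV (\<lambda>n k. coord (X n) k) l sequentially"
    using Cauchy_uniformly_convergent uniformly_convergent_on_def by blast
  have pt: "(\<lambda>n. coord (X n) k) \<longlonglongrightarrow> l k" for k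
    using tendsto_uniform_limitI[OF l] by simp
  have "l \<longlonglongrightarrow> 0"
    by (rule swap_uniform_limit'[OF _ tendsto_const l]) (auto simp: coord_tendsto_0)
  moreover have "l 0 = 0"
    using pt[of 0] by (simp add: LIMSEQ_const_iff)
  ultimately have L: "coord (Abs_c0 l) = l"
    by (simp add: Abs_c0_inverse null_seqs_def)
  have "X \<longlonglongrightarrow> Abs_c0 l"
  proof (rule metric_LIMSEQ_I)
    fix e :: real assume "e > 0"
    then have "\<forall>\<^sub>F n in sequentially. \<forall>k\<in>UNIV. dist (coord (X n) k) (l k) < e / 2"
      using l half_gt_zero unfolding uniform_limit_iff by blast
    then obtain N where N: "\<And>n k. n \<ge> N \<Longrightarrow> dist (coord (X n) k) (l k) < e / 2"
      by (auto simp: eventually_sequentially)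
    have "dist (X n) (Abs_c0 l) < e" if "n \<ge> N" for n
    proof -
      have "norm (X n - Abs_c0 l) \<le> e / 2"
        by (rule norm_c0_le) (use N[OF that] L in \<open>simp add: dist_norm less_imp_le\<close>)
      then show ?thesis using \<open>e > 0\<close> by (simp add: dist_norm)
    qed
    then show "\<exists>N. \<forall>n\<ge>N. dist (X n) (Abs_c0 l) < e" by blast
  qed
  then show "convergent X"
    by (rule convergentI)
qed

text \<open>
  A possibly unbounded operator \<open>T\<close> is a partial map with domain \<^term>\<open>dom T\<close>. Its powers are
  compositions of partial maps, so they carry their natural domain
  \<open>D(T\<^sup>n\<^sup>+\<^sup>1) = {x \<in> D(T). T x \<in> D(T\<^sup>n)}\<close>.
\<close>

primrec op_pow :: "('x \<rightharpoonup> 'x) \<Rightarrow> nat \<Rightarrow> ('x \<rightharpoonup> 'x)" where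
  "op_pow T 0 = Some"
| "op_pow T (Suc n) = T \<circ>\<^sub>m op_pow T n"

definition dom_infty :: "('x \<rightharpoonup> 'x) \<Rightarrow> 'x set" where
  "dom_infty T = (\<Inter>n\<in>{1..}. dom (op_pow T n))"

text \<open>
  For the operators below, linearity over the scalar field is built into the formula, so
  real linearity in \<^const>\<open>bounded_linear\<close> loses nothing.
\<close>

definition bounded_everywhere :: "('x::real_normed_vector \<rightharpoonup> 'x) \<Rightarrow> bool" where
  "bounded_everywhere T \<longleftrightarrow> dom T = UNIV \<and> bounded_linear (\<lambda>x. the (T x))"

definition densely_defined :: "('x::topological_space \<rightharpoonup> 'x) \<Rightarrow> bool" where
  "densely_defined T \<longleftrightarrow> closure (dom T) = UNIV"

definition orbit_of :: "('x \<rightharpoonup> 'x) \<Rightarrow> 'x \<Rightarrow> 'x set" where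
  "orbit_of T f = {g. \<exists>n. op_pow T n f = Some g}"

definition hypercyclic :: "('x::banach \<rightharpoonup> 'x) \<Rightarrow> bool" where
  "hypercyclic T \<longleftrightarrow>
     densely_defined T \<and> (\<exists>f\<in>dom_infty T. closure (orbit_of T f) = UNIV)"

definition periodic_points :: "('x \<rightharpoonup> 'x) \<Rightarrow> 'x set" where
  "periodic_points T = {f. \<exists>n\<ge>1. op_pow T n f = Some f}"

definition chaotic :: "('x::banach \<rightharpoonup> 'x) \<Rightarrow> bool" where
  "chaotic T \<longleftrightarrow> hypercyclic T \<and> closure (periodic_points T) = UNIV"

definition weighted_pseudo_shift ::
  "(nat \<Rightarrow> 'a::real_normed_field) \<Rightarrow> (nat \<Rightarrow> nat) \<Rightarrow> ('a c0 \<rightharpoonup> 'a c0)" where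
  "weighted_pseudo_shift w \<phi> x =
     (if (\<lambda>k. w k * coord x (\<phi> k)) \<in> null_seqs
      then Some (Abs_c0 (\<lambda>k. w k * coord x (\<phi> k))) else None)"

lemma weighted_pseudo_shift_eq_Some_iff:
  "weighted_pseudo_shift w \<phi> x = Some y \<longleftrightarrow> (\<forall>k. coord y k = w k * coord x (\<phi> k))"
proof -
  have "coord y = (\<lambda>k. w k * coord x (\<phi> k)) \<longleftrightarrow>
      (\<lambda>k. w k * coord x (\<phi> k)) \<in> null_seqs \<and> Abs_c0 (\<lambda>k. w k * coord x (\<phi> k)) = y"
    by (metis Abs_c0_inverse coord coord_inverse)
  then show ?thesis
    by (auto simp: weighted_pseudo_shift_def fun_eq_iff)
qed

text \<open>The product \<open>w\<^sub>k w\<^bsub>\<phi>(k)\<^esub> \<cdots> w\<^bsub>\<phi>\<^sup>n\<^sup>-\<^sup>1(k)\<^esub>\<close>.\<close>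

definition forward_prod :: "(nat \<Rightarrow> 'a::real_normed_field) \<Rightarrow> (nat \<Rightarrow> nat) \<Rightarrow> nat \<Rightarrow> nat \<Rightarrow> 'a" where
  "forward_prod w \<phi> n k = (\<Prod>i<n. w ((\<phi> ^^ i) k))"

text \<open>
  The powers of a weighted pseudo-shift are given by the expected coordinate formula. Membership
  in \<open>D(T\<^sup>n)\<close> requires the formulas of all orders up to \<open>n\<close> to give null sequences; in the
  intersection over all \<open>n\<close> this makes no difference.
\<close>

lemma op_pow_weighted_pseudo_shift:
  "op_pow (weighted_pseudo_shift w \<phi>) n x = Some y \<Longrightarrow>
     coord y k = forward_prod w \<phi> n k * coord x ((\<phi> ^^ n) k)"
proof (induction n arbitrary: y k)
  case 0
  then show ?case by (simp add: forward_prod_def)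
next
  case (Suc n)
  then obtain z where z: "op_pow (weighted_pseudo_shift w \<phi>) n x = Some z"
    "weighted_pseudo_shift w \<phi> z = Some y"
    by (auto simp: map_comp_Some_iff)
  have "coord y k = w k * (forward_prod w \<phi> n (\<phi> k) * coord x ((\<phi> ^^ n) (\<phi> k)))"
    using Suc.IH[OF z(1)] z(2) by (simp add: weighted_pseudo_shift_eq_Some_iff)
  moreover have "forward_prod w \<phi> (Suc n) k = w k * forward_prod w \<phi> n (\<phi> k)"
    unfolding forward_prod_def
    by (subst prod.lessThan_Suc_shift) (simp add: funpow_swap1)
  ultimately show ?case
    by (simp add: funpow_swap1 mult.assoc)
qed

lemma dom_op_pow_weighted_pseudo_shift:
  "dom (op_pow (weighted_pseudo_shift w \<phi>) n) =
     {x. \<forall>j\<in>{1..n}. (\<lambda>k. forward_prod w \<phi> j k * coord x ((\<phi> ^^ j) k)) \<in> null_seqs}"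
proof (induction n)
  case 0
  then show ?case by auto
next
  case (Suc n)
  let ?T = "weighted_pseudo_shift w \<phi>"
  let ?s = "\<lambda>x j k. forward_prod w \<phi> j k * coord x ((\<phi> ^^ j) k)"
  have "x \<in> dom (op_pow ?T (Suc n)) \<longleftrightarrow> x \<in> dom (op_pow ?T n) \<and> ?s x (Suc n) \<in> null_seqs" for x
  proof
    assume "x \<in> dom (op_pow ?T (Suc n))"
    then obtain y where y: "op_pow ?T (Suc n) x = Some y" by blast
    then have "coord y = ?s x (Suc n)"
      using op_pow_weighted_pseudo_shift by blast
    then have "?s x (Suc n) \<in> null_seqs" by (metis coord)
    then show "x \<in> dom (op_pow ?T n) \<and> ?s x (Suc n) \<in> null_seqs"
      using y by (auto simp: map_comp_Some_iff)
  next
    assume *: "x \<in> dom (op_pow ?T n) \<and> ?s x (Suc n) \<in> null_seqs"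
    then obtain z where z: "op_pow ?T n x = Some z" by blast
    have "w k * coord z (\<phi> k) = ?s x (Suc n) k" for k
    proof -
      have "forward_prod w \<phi> (Suc n) k = w k * forward_prod w \<phi> n (\<phi> k)"
        unfolding forward_prod_def
        by (subst prod.lessThan_Suc_shift) (simp add: funpow_swap1)
      then show ?thesis
        using op_pow_weighted_pseudo_shift[OF z, of "\<phi> k"] by (simp add: funpow_swap1 mult.assoc)
    qed
    then have "(\<lambda>k. w k * coord z (\<phi> k)) \<in> null_seqs"
      using * by simp
    then show "x \<in> dom (op_pow ?T (Suc n))"
      using z by (simp add: dom_def weighted_pseudo_shift_def map_comp_Some_iff)
  qed
  then show ?case
    using Suc.IH by (auto simp: atLeastAtMostSuc_conv)
qed

lemma dom_infty_weighted_pseudo_shift: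
  "dom_infty (weighted_pseudo_shift w \<phi>) =
     (\<Inter>n\<in>{1..}. {x. (\<lambda>k. forward_prod w \<phi> n k * coord x ((\<phi> ^^ n) k)) \<in> null_seqs})"
  unfolding dom_infty_def dom_op_pow_weighted_pseudo_shift by fastforce

text \<open>The iterate \<open>\<phi>\<^sup>-\<^sup>n(k)\<close>, with value 0 if \<open>k\<close> has no \<open>n\<close>-th preimage; meant for injective \<open>\<phi>\<close>.\<close>

definition neg_iter :: "(nat \<Rightarrow> nat) \<Rightarrow> nat \<Rightarrow> nat \<Rightarrow> nat" where
  "neg_iter \<phi> n k =
     (if \<exists>l\<ge>1. (\<phi> ^^ n) l = k then THE l. 1 \<le> l \<and> (\<phi> ^^ n) l = k else 0)"

definition backward_prod :: "(nat \<Rightarrow> 'a::real_normed_field) \<Rightarrow> (nat \<Rightarrow> nat) \<Rightarrow> nat \<Rightarrow> nat \<Rightarrow> 'a" where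
  "backward_prod w \<phi> n k = (\<Prod>i=1..n. w (neg_iter \<phi> i k))"

end

theory Submission
  imports Defs
begin

text \<open>
  Write \<open>T\<close> for the pseudo-shift, \<open>W\<^sub>n(k)\<close> for the forward product
  \<open>w\<^sub>k w\<^bsub>\<phi>(k)\<^esub> \<cdots> w\<^bsub>\<phi>\<^sup>n\<^sup>-\<^sup>1(k)\<^esub>\<close>; thus
  \<open>(T\<^sup>n x)\<^sub>k = W\<^sub>n(k) x\<^bsub>\<phi>\<^sup>n(k)\<^esub>\<close>.

  \<^emph>\<open>Necessity.\<close> If \<open>\<phi>(i) = \<phi>(j)\<close> with \<open>i \<noteq> j\<close>, every vector in the range of \<open>T\<close> satisfies
  \<open>w\<^sub>j y\<^sub>i = w\<^sub>i y\<^sub>j\<close>, and a dense orbit does not fit into a proper closed subspace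
  (\<open>functional_vanishing_on_range_eq_0\<close>); the same remark gives \<open>w\<^sub>k \<noteq> 0\<close>. Since periodic points are
  dense, each coordinate \<open>k\<close> is nonzero at some periodic point \<open>p\<close>. If \<open>\<phi>\<^sup>n(k) = k\<close>, then
  periodicity of \<open>p\<close> forces \<open>|W\<^sub>n(k)| = 1\<close>, so the \<open>k\<close>-th coordinates along any orbit are bounded and no
  orbit is dense. For the growth conditions, the orbit of \<open>p\<close> is a \<^emph>\<open>finite\<close> set of null sequences and
  hence uniformly null. As \<open>\<phi>\<close> has no cycles, \<open>\<phi>\<^sup>n(k)\<close> and the \<open>n\<close>-th preimages \<open>l\<^sub>n\<close> of \<open>k\<close> tend to
  infinity, so \<open>p\<^sub>k = W\<^sub>n(k) q\<^bsub>\<phi>\<^sup>n(k)\<^esub>\<close> with \<open>q\<close> in the orbit makes \<open>|W\<^sub>n(k)|\<close> large, and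
  \<open>(T\<^sup>n p)\<^bsub>l\<^sub>n\<^esub> = W\<^sub>n(l\<^sub>n) p\<^sub>k\<close> makes \<open>W\<^sub>n(l\<^sub>n)\<close>, which is the backward product, small.

  \<^emph>\<open>Sufficiency.\<close> The full two-sided orbit of \<open>k\<close> under \<open>\<phi>\<close> carries a solution \<open>u\<close> of
  \<open>w\<^sub>l u\<^bsub>\<phi>(l)\<^esub> = u\<^sub>l\<close> with \<open>u\<^sub>k = 1\<close>, namely \<open>u\<^sub>l = W\<^sub>m(l) / W\<^sub>n(k)\<close> whenever
  \<open>\<phi>\<^sup>m(l) = \<phi>\<^sup>n(k)\<close>. The two limits say precisely that \<open>u\<close> tends to zero at both ends of the orbit, so
  every restriction of \<open>u\<close> to a set \<open>A\<close> of times in \<open>\<int>\<close> lies in \<open>c\<^sub>0\<close>,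
  where membership asks only that the coordinates tend to zero. On such restrictions \<open>T\<close> acts by translating \<open>A\<close>
  by one (\<open>pseudo_shift_orbit_sum\<close>). The choice \<open>A = {0}\<close> gives the unit sequence \<open>e\<^sub>k\<close>; \<open>A = N\<int>\<close> gives
  periodic points that approximate it for large \<open>N\<close> (\<open>periodic_points_dense\<close>); and \<open>A = {n}\<close>,
  \<open>n \<in> \<int>\<close>, is a two-sided \<open>T\<close>-orbit through \<open>e\<^sub>k\<close> that tends to zero in both time directions. Finite
  linear combinations of these produce a dense sequence of vectors with such orbits, which for an
  linear operator with closed graph is enough for hypercyclicity
  (\<open>hypercyclic_if_two_sided_orbits\<close>).
\<close>

section \<open>Partial operators and their iterates\<close>

lemma op_pow_iterates:
  assumes "\<And>n. T (F n) = Some (F (Suc n))"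
  shows "op_pow T n (F m) = Some (F (m + n))"
  by (induction n) (simp_all add: assms)

text \<open>
  Unrolling a periodic point into a total sequence avoids any further bookkeeping about domains.
\<close>

lemma periodic_orbit:
  assumes "op_pow T N p = Some p" and "N \<ge> 1"
  obtains P where "P 0 = p" and "\<And>n. T (P n) = Some (P (Suc n))"
    and "\<And>n. P (n * N) = p" and "finite (range P)"
proof
  define P where "P n = the (op_pow T (n mod N) p)" for n
  have some: "n \<le> N \<Longrightarrow> op_pow T n p \<noteq> None" for n
  proof (induction rule: inc_induct)
    case base
    then show ?case using assms by simp
  next
    case (step n)
    then show ?case by (auto simp: map_comp_def split: option.splits)
  qed
  have P_eq: "n \<le> N \<Longrightarrow> op_pow T n p = Some (P n)" for n
    using some[of n] assms by (cases "n = N") (auto simp: P_def)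
  show "P 0 = p" "P (n * N) = p" for n
    by (simp_all add: P_def)
  show "T (P n) = Some (P (Suc n))" for n
  proof -
    have lt: "n mod N < N" using assms by simp
    have "T (P (n mod N)) = Some (P (Suc (n mod N)))"
      using P_eq[of "Suc (n mod N)"] P_eq[of "n mod N"] lt by (simp add: map_comp_Some_iff)
    moreover have "P (n mod N) = P n" "P (Suc (n mod N)) = P (Suc n)"
      by (simp_all add: P_def mod_Suc_eq)
    ultimately show ?thesis by simp
  qed
  have "P n \<in> P ` {..<N}" for n
    using assms by (intro image_eqI[of _ _ "n mod N"]) (auto simp: P_def)
  then have "range P \<subseteq> P ` {..<N}" by blast
  then show "finite (range P)"
    using finite_surj by blast
qed

text \<open>
  All points of the orbit but the first one lie in the range of \<open>T\<close>. A closed proper subspace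
  together with one more point is never the whole space: it misses \<open>x\<close> or \<open>2x\<close>.
\<close>

lemma functional_vanishing_on_range_eq_0:
  fixes T :: "'x::real_normed_vector \<rightharpoonup> 'x" and L :: "'x \<Rightarrow> 'y::real_normed_vector"
  assumes dense: "closure (orbit_of T f) = UNIV" and L: "bounded_linear L"
    and ker: "\<And>x y. T x = Some y \<Longrightarrow> L y = 0"
  shows "L x = 0"
proof (rule ccontr)
  assume x: "L x \<noteq> 0"
  interpret bounded_linear L by (fact L)
  have "orbit_of T f \<subseteq> insert f {y. L y = 0}"
  proof
    fix g assume "g \<in> orbit_of T f"
    then obtain n where "op_pow T n f = Some g" by (auto simp: orbit_of_def)
    then show "g \<in> insert f {y. L y = 0}"
      by (cases n) (auto simp: map_comp_Some_iff ker)
  qed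
  moreover have "closed (insert f {y. L y = 0})"
    by (intro closed_insert closed_Collect_eq continuous_on continuous_intros)
  ultimately have all: "y \<in> insert f {y. L y = 0}" for y
    using closure_minimal dense by blast
  have "x = f" "2 *\<^sub>R x = f"
    using all[of x] all[of "2 *\<^sub>R x"] x by (simp_all add: scaleR)
  then have "x = 0" by (metis scaleR_2 add_cancel_right_left)
  then show False using x zero by simp
qed

lemma sums_in_closed_subspace:
  fixes v :: "nat \<Rightarrow> 'x::real_normed_vector"
  assumes "closed G" "subspace G" "v sums s" "\<And>n. v n \<in> G"
  shows "s \<in> G"
proof (rule closed_sequentially[OF \<open>closed G\<close>])
  show "(\<Sum>i<n. v i) \<in> G" for n
    by (rule subspace_sum) (use assms in auto)
  show "(\<lambda>n. \<Sum>i<n. v i) \<longlonglongrightarrow> s"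
    using assms by (simp add: sums_def)
qed

text \<open>
  A hypercyclicity criterion. List the vectors \<open>d\<^sub>j\<close> of the dense sequence so that each of them recurs
  infinitely often, and let \<open>d\<^sub>j(n)\<close> be the two-sided orbit of \<open>d\<^sub>j\<close>. The hypercyclic vector is
  \<open>\<Sum>\<^sub>j d\<^sub>j(- N\<^sub>j)\<close> for times \<open>N\<^sub>j\<close> with rapidly growing gaps. Closedness of the graph lets \<open>T\<close> act term
  by term, so the orbit at time \<open>N\<^sub>i\<close> is \<open>d\<^sub>i\<close> plus terms taken at times far from 0, which are small.
  Convergence of \<open>\<Sum>\<^sub>j d\<^sub>j(n - N\<^sub>j)\<close> for \<^emph>\<open>every\<close> \<open>n\<close> keeps the vector in the domain of all powers.
\<close>

lemma hypercyclic_if_two_sided_orbits: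
  fixes T :: "'x::banach \<rightharpoonup> 'x" and V :: "nat \<Rightarrow> int \<Rightarrow> 'x"
  assumes closed: "closed {(x, y). T x = Some y}"
    and subspace: "subspace {(x, y). T x = Some y}"
    and step: "\<And>i n. T (V i n) = Some (V i (n + 1))"
    and small: "\<And>i e. e > 0 \<Longrightarrow> \<exists>M. \<forall>n. \<bar>n\<bar> \<ge> M \<longrightarrow> norm (V i n) \<le> e"
    and dense: "closure (range (\<lambda>i. V i 0)) = UNIV"
  shows "hypercyclic T"
proof -
  define d where "d j = V (fst (prod_decode j))" for j
  have d_step: "T (d j n) = Some (d j (n + 1))" for j n
    by (simp add: d_def step)
  \<comment> \<open>The gap before \<open>N\<^sub>i\<close> must serve \<open>d\<^sub>i\<close> and all earlier vectors. The rate \<open>4\<^sup>-\<^sup>i\<close> is chosen since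
      \<open>4\<^bsup>-max i j\<^esup> \<le> 2\<^sup>-\<^sup>i 2\<^sup>-\<^sup>j\<close>, which is summable in \<open>j\<close> with a sum that vanishes as \<open>i\<close> grows.\<close>
  have "\<exists>M\<ge>1. \<forall>n j. \<bar>n\<bar> \<ge> M \<longrightarrow> j \<le> i \<longrightarrow> norm (d j n) \<le> (1/4) ^ i" for i
  proof -
    have "\<exists>M. \<forall>n. \<bar>n\<bar> \<ge> M \<longrightarrow> norm (d j n) \<le> (1/4) ^ i" for j
      unfolding d_def by (rule small) simp
    then obtain M where M: "\<And>j n. \<bar>n\<bar> \<ge> M j \<Longrightarrow> norm (d j n) \<le> (1/4) ^ i" by metis
    let ?M = "Max (insert 1 (M ` {..i}))"
    have "?M \<ge> 1" "j \<le> i \<Longrightarrow> M j \<le> ?M" for j by (rule Max_ge; simp)+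
    with M show ?thesis by (meson order_trans)
  qed
  then obtain M where M1: "\<And>i. M i \<ge> 1"
    and M: "\<And>i j n. \<bar>n\<bar> \<ge> M i \<Longrightarrow> j \<le> i \<Longrightarrow> norm (d j n) \<le> (1/4) ^ i"
    by metis
  define N where "N i = (\<Sum>l\<le>i. M l)" for i
  have gap: "N i + M j \<le> N j" if "i < j" for i j
  proof -
    have "N j = (\<Sum>l<j. M l) + M j"
      by (simp add: N_def lessThan_Suc_atMost[symmetric])
    moreover have "N i \<le> (\<Sum>l<j. M l)"
      unfolding N_def using that M1 by (intro sum_mono2) (auto intro: order_trans[OF _ M1])
    ultimately show ?thesis by simp
  qed
  have N_ge: "int i + 1 \<le> N i" for i
  proof (induction i)
    case 0
    then show ?case using M1 by (simp add: N_def)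
  next
    case (Suc i)
    then show ?case using M1[of "Suc i"] by (simp add: N_def)
  qed
  define F where "F n = (\<Sum>j. d j (int n - N j))" for n
  have summ: "summable (\<lambda>j. d j (int n - N j))" for n
  proof (rule summable_comparison_test')
    show "summable (\<lambda>j. (1/4::real) ^ j)" by (rule summable_geometric) simp
    show "norm (d j (int n - N j)) \<le> (1/4) ^ j" if "j \<ge> Suc n" for j
      using gap[of n j] N_ge[of n] that by (intro M) auto
  qed
  have F_step: "T (F n) = Some (F (Suc n))" for n
  proof -
    have "(\<lambda>j. d j (int (Suc n) - N j)) sums F (Suc n)" "(\<lambda>j. d j (int n - N j)) sums F n"
      unfolding F_def by (intro summable_sums summ)+
    moreover have "(\<Sum>j<m. (d j (int n - N j), d j (int (Suc n) - N j))) =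
        (\<Sum>j<m. d j (int n - N j), \<Sum>j<m. d j (int (Suc n) - N j))" for m
      by (simp add: prod_eq_iff fst_sum snd_sum)
    ultimately have "(\<lambda>j. (d j (int n - N j), d j (int (Suc n) - N j))) sums (F n, F (Suc n))"
      unfolding sums_def by (simp only: tendsto_Pair)
    then have "(F n, F (Suc n)) \<in> {(x, y). T x = Some y}"
    proof (rule sums_in_closed_subspace[OF closed subspace])
      show "(d j (int n - N j), d j (int (Suc n) - N j)) \<in> {(x, y). T x = Some y}" for j
        using d_step[of j "int n - N j"] by (simp add: algebra_simps)
    qed
    then show ?thesis by simp
  qed
  have pow: "op_pow T n (F 0) = Some (F n)" for n
    using op_pow_iterates[of T F n 0] F_step by simp
  have close: "norm (F (nat (N i)) - d i 0) \<le> 2 * (1/2) ^ i" for i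
  proof -
    define t where "t j = (if j = i then 0 else d j (N i - N j))" for j
    have Ni: "int (nat (N i)) = N i" using N_ge[of i] by simp
    have t_le: "norm (t j) \<le> (1/2) ^ i * (1/2) ^ j" for j
    proof -
      have q: "(1/4::real) ^ m \<le> (1/2) ^ m * (1/2) ^ n" if "n \<le> m" for m n
      proof -
        have "(1/4::real) ^ m = (1/2) ^ m * (1/2) ^ m" by (simp flip: power_mult_distrib)
        also have "\<dots> \<le> (1/2) ^ m * (1/2) ^ n"
          using that by (intro mult_left_mono power_decreasing) auto
        finally show ?thesis .
      qed
      consider "j < i" | "j = i" | "i < j" by linarith
      then show ?thesis
      proof cases
        case 1
        then have "norm (t j) \<le> (1/4) ^ i"
          using gap[OF 1] by (auto simp: t_def intro!: M)
        then show ?thesis using q[of j i] 1 by linarith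
      next
        case 3
        then have "norm (t j) \<le> (1/4) ^ j"
          using gap[OF 3] by (auto simp: t_def intro!: M)
        then show ?thesis using q[of i j] 3 by (simp add: mult.commute)
      qed (simp add: t_def)
    qed
    have g: "(\<lambda>j. (1/2) ^ i * (1/2) ^ j :: real) sums ((1/2) ^ i * 2)"
      using geometric_sums[of "1/2::real"] by (intro sums_mult) simp
    have "(\<lambda>j. if j = i then d i 0 else 0) sums d i 0"
      using sums_single[of i "\<lambda>_. d i 0"] by simp
    moreover have "(\<lambda>j. d j (N i - N j)) sums F (nat (N i))"
      using summable_sums[OF summ[of "nat (N i)"]] unfolding F_def Ni .
    ultimately have "(\<lambda>j. d j (N i - N j) - (if j = i then d i 0 else 0)) sums (F (nat (N i)) - d i 0)"
      by (intro sums_diff)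
    moreover have "(\<lambda>j. d j (N i - N j) - (if j = i then d i 0 else 0)) = t"
      by (auto simp: t_def)
    ultimately have "F (nat (N i)) - d i 0 = suminf t" by (simp add: sums_unique)
    also have "norm \<dots> \<le> (\<Sum>j. (1/2) ^ i * (1/2) ^ j)"
      by (rule norm_suminf_le) (use t_le sums_summable[OF g] in auto)
    finally show ?thesis using sums_unique[OF g] by (simp add: mult.commute)
  qed
  have "\<exists>g\<in>orbit_of T (F 0). dist g y < e" if "e > 0" for y and e :: real
  proof -
    have "y \<in> closure (range (\<lambda>i. V i 0))" by (simp add: dense)
    then obtain a where a: "dist (V a 0) y < e / 2"
      using \<open>e > 0\<close> unfolding closure_approachable by (metis half_gt_zero imageE)
    obtain b where b: "(1/2::real) ^ b < e / 4"
      using real_arch_pow_inv[of "e/4" "1/2"] \<open>e > 0\<close> by auto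
    \<comment> \<open>The second component only enforces a late occurrence of the vector with index \<open>a\<close>.\<close>
    let ?i = "prod_encode (a, b)"
    have "(1/2::real) ^ ?i \<le> (1/2) ^ b"
      by (intro power_decreasing le_prod_encode_2) auto
    moreover have "norm (F (nat (N ?i)) - V a 0) \<le> 2 * (1/2) ^ ?i"
      using close[of ?i] by (simp add: d_def)
    ultimately have "norm (F (nat (N ?i)) - V a 0) < e / 2"
      using b by linarith
    then have "dist (F (nat (N ?i))) y < e"
      using a dist_triangle[of "F (nat (N ?i))" y "V a 0"] by (simp only: dist_norm)
    then show ?thesis
      using pow by (auto simp: orbit_of_def)
  qed
  then have "closure (orbit_of T (F 0)) = UNIV"
    by (auto simp: closure_approachable)
  moreover have "F 0 \<in> dom_infty T"
    using pow by (auto simp: dom_infty_def)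
  moreover have "densely_defined T"
  proof -
    have "range (\<lambda>i. V i 0) \<subseteq> dom T" using step by auto
    then show ?thesis
      using closure_mono dense unfolding densely_defined_def by blast
  qed
  ultimately show ?thesis by (auto simp: hypercyclic_def)
qed

section \<open>The graph of a weighted pseudo-shift\<close>

lemma bounded_linear_coord: "bounded_linear (\<lambda>x. coord x k)"
  by (rule bounded_linear_intro[where K = 1]) (simp_all add: norm_coord_le)

lemma unit_vector_exists:
  assumes "k \<ge> 1"
  obtains e :: "'a::real_normed_field c0" where "coord e = (\<lambda>l. if l = k then 1 else 0)"
proof
  have "(\<lambda>l. if l = k then 1 else 0 :: 'a) \<longlonglongrightarrow> 0"
    by (rule tendsto_eventually) (auto simp: eventually_sequentially intro!: exI[of _ "Suc k"])
  then show "coord (Abs_c0 (\<lambda>l. if l = k then 1 else 0)) = (\<lambda>l. if l = k then 1 else 0 :: 'a)"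
    using assms by (intro Abs_c0_inverse) (simp add: null_seqs_def)
qed

lemma closed_graph_weighted_pseudo_shift:
  "closed {(x, y). weighted_pseudo_shift w \<phi> x = Some y}"
proof -
  have "{(x, y). weighted_pseudo_shift w \<phi> x = Some y} =
      (\<Inter>k. {p. coord (snd p) k = w k * coord (fst p) (\<phi> k)})"
    by (auto simp: weighted_pseudo_shift_eq_Some_iff)
  also have "closed \<dots>"
    by (intro closed_INT ballI closed_Collect_eq continuous_intros
        bounded_linear.continuous_on[OF bounded_linear_coord])
  finally show ?thesis .
qed

lemma subspace_graph_weighted_pseudo_shift:
  "subspace {(x, y). weighted_pseudo_shift w \<phi> x = Some y}"
  by (auto simp: subspace_def weighted_pseudo_shift_eq_Some_iff zero_prod_def distrib_left)

lemma forward_prod_add: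
  "forward_prod w \<phi> (m + n) k = forward_prod w \<phi> m k * forward_prod w \<phi> n ((\<phi> ^^ m) k)"
proof (induction n)
  case (Suc n)
  have "(\<phi> ^^ (m + n)) k = (\<phi> ^^ n) ((\<phi> ^^ m) k)"
    by (metis add.commute comp_apply funpow_add)
  with Suc show ?case by (simp add: forward_prod_def)
qed (simp add: forward_prod_def)

section \<open>Injective self-maps without periodic points\<close>

locale free_injection =
  fixes \<phi> :: "nat \<Rightarrow> nat"
  assumes maps: "k \<ge> 1 \<Longrightarrow> \<phi> k \<ge> 1"
    and inj: "inj_on \<phi> {1..}"
    and no_cycle: "n \<ge> 1 \<Longrightarrow> k \<ge> 1 \<Longrightarrow> (\<phi> ^^ n) k \<noteq> k"
begin

lemma iter_pos: "k \<ge> 1 \<Longrightarrow> (\<phi> ^^ n) k \<ge> 1"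
  by (induction n) (simp_all add: maps[simplified])

lemma iter_iter: "(\<phi> ^^ m) ((\<phi> ^^ n) k) = (\<phi> ^^ (n + m)) k"
  by (metis add.commute comp_apply funpow_add)

lemma iter_inj: "(\<phi> ^^ n) k = (\<phi> ^^ n) l \<Longrightarrow> k \<ge> 1 \<Longrightarrow> l \<ge> 1 \<Longrightarrow> k = l"
  by (induction n) (use inj iter_pos in \<open>auto simp: inj_on_def\<close>)

lemma iter_index_inj:
  assumes "(\<phi> ^^ m) k = (\<phi> ^^ n) k" "k \<ge> 1"
  shows "m = n"
  using assms(1)
proof (induction m n rule: linorder_wlog)
  case (le m n)
  then have "(\<phi> ^^ m) ((\<phi> ^^ (n - m)) k) = (\<phi> ^^ m) k" by (simp add: iter_iter)
  then have "(\<phi> ^^ (n - m)) k = k" using iter_inj iter_pos assms(2) by blast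
  then have "\<not> n - m \<ge> 1" using no_cycle assms(2) by blast
  then show ?case using le by simp
qed simp

lemma backward_prod_preimage:
  assumes "(\<phi> ^^ n) l = k" "l \<ge> 1"
  shows "backward_prod w \<phi> n k = forward_prod w \<phi> n l"
proof -
  have "neg_iter \<phi> i k = (\<phi> ^^ (n - i)) l" if "i \<le> n" for i
  proof -
    have "(\<phi> ^^ i) ((\<phi> ^^ (n - i)) l) = k" using assms that by (simp add: iter_iter)
    moreover from this have "(THE l'. 1 \<le> l' \<and> (\<phi> ^^ i) l' = k) = (\<phi> ^^ (n - i)) l"
      using iter_inj iter_pos[OF assms(2)] by (intro the_equality) auto
    ultimately show ?thesis
      using iter_pos[OF assms(2)] by (auto simp: neg_iter_def)
  qed
  then have "backward_prod w \<phi> n k = (\<Prod>i=1..n. w ((\<phi> ^^ (n - i)) l))"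
    by (simp add: backward_prod_def)
  also have "\<dots> = forward_prod w \<phi> n l"
    unfolding forward_prod_def
    by (rule prod.reindex_bij_witness[of _ "\<lambda>i. n - i" "\<lambda>i. n - i"]) auto
  finally show ?thesis .
qed

lemma backward_prod_no_preimage:
  assumes "\<nexists>l. l \<ge> 1 \<and> (\<phi> ^^ n) l = k" "k \<ge> 1" "w 0 = 0"
  shows "backward_prod w \<phi> n k = 0"
proof -
  have "n \<ge> 1" using assms(1,2) by (cases n) auto
  moreover have "w (neg_iter \<phi> n k) = 0" using assms by (auto simp: neg_iter_def)
  ultimately show ?thesis by (auto simp: backward_prod_def prod_zero_iff)
qed

text \<open>
  The point \<open>l\<close> lies on the two-sided orbit of \<open>k\<close> and reaches \<open>k\<close> after \<open>s\<close> steps; for negative \<open>s\<close>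
  it is the point that \<open>k\<close> reaches after \<open>-s\<close> steps. Allowing a common later point as a witness treats
  both signs at once.
\<close>

definition hits :: "nat \<Rightarrow> nat \<Rightarrow> int \<Rightarrow> bool" where
  "hits k l s \<longleftrightarrow> l \<ge> 1 \<and> (\<exists>m n. (\<phi> ^^ m) l = (\<phi> ^^ n) k \<and> s = int m - int n)"

lemma hits_time_unique:
  assumes "hits k l s" "hits k l s'" "k \<ge> 1"
  shows "s = s'"
proof -
  obtain m n m' n' where *: "(\<phi> ^^ m) l = (\<phi> ^^ n) k" "s = int m - int n"
    "(\<phi> ^^ m') l = (\<phi> ^^ n') k" "s' = int m' - int n'"
    using assms by (auto simp: hits_def)
  have "(\<phi> ^^ (n + m')) k = (\<phi> ^^ (n' + m)) k"
    by (metis *(1,3) iter_iter add.commute)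
  then have "n + m' = n' + m" using iter_index_inj assms by blast
  then show ?thesis using * by simp
qed

lemma hits_source_unique:
  assumes "hits k l s" "hits k l' s"
  shows "l = l'"
proof -
  obtain m n m' n' where *: "(\<phi> ^^ m) l = (\<phi> ^^ n) k" "s = int m - int n"
    "(\<phi> ^^ m') l' = (\<phi> ^^ n') k" "s = int m' - int n'"
    using assms by (auto simp: hits_def)
  then have "n + m' = n' + m" by simp
  then have "(\<phi> ^^ (m + m')) l = (\<phi> ^^ (m + m')) l'"
    by (metis *(1,3) iter_iter add.commute)
  then show ?thesis using iter_inj assms by (auto simp: hits_def)
qed

lemma hits_0: "hits k l 0 \<longleftrightarrow> l = k" if "k \<ge> 1"
proof
  have "hits k k 0" unfolding hits_def using that by force
  then show "l = k \<Longrightarrow> hits k l 0" "hits k l 0 \<Longrightarrow> l = k"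
    using hits_source_unique by blast+
qed

lemma hits_step: "hits k (\<phi> l) s \<longleftrightarrow> hits k l (s + 1)" if "l \<ge> 1"
proof
  assume "hits k (\<phi> l) s"
  then obtain m n where "(\<phi> ^^ m) (\<phi> l) = (\<phi> ^^ n) k" "s = int m - int n"
    by (auto simp: hits_def)
  then have "(\<phi> ^^ Suc m) l = (\<phi> ^^ n) k" "s + 1 = int (Suc m) - int n"
    by (simp_all add: funpow_swap1)
  then show "hits k l (s + 1)" using that unfolding hits_def by blast
next
  assume "hits k l (s + 1)"
  then obtain m n where "(\<phi> ^^ m) l = (\<phi> ^^ n) k" "s + 1 = int m - int n"
    by (auto simp: hits_def)
  then have "(\<phi> ^^ m) (\<phi> l) = (\<phi> ^^ Suc n) k" "s = int m - int (Suc n)"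
    by (simp_all flip: funpow_swap1)
  then show "hits k (\<phi> l) s" using that maps unfolding hits_def by blast
qed

lemma hits_nonneg: "hits k l (int n) \<Longrightarrow> k \<ge> 1 \<Longrightarrow> (\<phi> ^^ n) l = k"
proof (induction n arbitrary: l)
  case (Suc n)
  then have "hits k (\<phi> l) (int n)"
    by (subst hits_step) (auto simp: hits_def algebra_simps)
  then show ?case using Suc by (simp add: funpow_swap1)
qed (simp add: hits_0)

lemma hits_nonpos: "hits k l (- int n) \<Longrightarrow> k \<ge> 1 \<Longrightarrow> l = (\<phi> ^^ n) k"
proof (rule hits_source_unique)
  assume "k \<ge> 1"
  moreover have "(\<phi> ^^ 0) ((\<phi> ^^ n) k) = (\<phi> ^^ n) k" "- int n = int 0 - int n" by simp_all
  ultimately show "hits k ((\<phi> ^^ n) k) (- int n)"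
    using iter_pos unfolding hits_def by blast
qed

end

section \<open>Necessity\<close>

text \<open>
  Starting at an arbitrary time \<open>m\<close> matters on a periodic orbit: for every \<open>n\<close> there is then an \<open>m\<close> for
  which the vector at time \<open>m + n\<close> is the initial one.
\<close>

lemma orbit_coord:
  assumes "\<And>n. weighted_pseudo_shift w \<phi> (P n) = Some (P (Suc n))"
  shows "coord (P (m + n)) k = forward_prod w \<phi> n k * coord (P m) ((\<phi> ^^ n) k)"
  using op_pow_iterates[of "weighted_pseudo_shift w \<phi>" P n m] assms op_pow_weighted_pseudo_shift
  by blast

lemma periodic_orbit_charging_coordinate:
  fixes w :: "nat \<Rightarrow> 'a::{real_normed_field, banach}"
  assumes "chaotic (weighted_pseudo_shift w \<phi>)" and "k \<ge> 1"
  obtains N and P :: "nat \<Rightarrow> 'a c0" where "coord (P 0) k \<noteq> 0"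
    and "\<And>n. weighted_pseudo_shift w \<phi> (P n) = Some (P (Suc n))"
    and "N \<ge> 1" and "\<And>n. P (n * N) = P 0" and "finite (range P)"
proof -
  let ?T = "weighted_pseudo_shift w \<phi>"
  have "\<exists>p\<in>periodic_points ?T. coord p k \<noteq> 0"
  proof (rule ccontr)
    assume "\<not> ?thesis"
    then have "periodic_points ?T \<subseteq> {x. coord x k = 0}" by blast
    moreover have "closed {x :: 'a c0. coord x k = 0}"
      by (intro closed_Collect_eq continuous_intros
          bounded_linear.continuous_on[OF bounded_linear_coord])
    ultimately have "coord x k = 0" for x :: "'a c0"
      using assms(1) closure_minimal unfolding chaotic_def by blast
    moreover obtain e :: "'a c0" where "coord e = (\<lambda>l. if l = k then 1 else 0)"
      using unit_vector_exists assms(2) by blast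
    ultimately show False by (metis zero_neq_one)
  qed
  then obtain p N where p: "coord p k \<noteq> 0" "N \<ge> 1" "op_pow ?T N p = Some p"
    by (auto simp: periodic_points_def)
  then obtain P where "P 0 = p" "\<And>n. ?T (P n) = Some (P (Suc n))"
    "\<And>n. P (n * N) = p" "finite (range P)"
    using periodic_orbit by metis
  then show thesis using that[of P N] p by simp
qed

text \<open>
  The weights cannot vanish and \<open>\<phi>\<close> cannot identify two indices, because either would confine the
  range of \<open>T\<close> to a closed hyperplane. A cycle through \<open>k\<close> is excluded by playing the two halves of
  chaos against each other: a periodic point with nonzero \<open>k\<close>-th coordinate fixes the modulus of the
  product along the cycle to be 1, and then a hypercyclic orbit would have bounded \<open>k\<close>-th coordinate.
\<close>

lemma chaotic_imp_free_injection:
  fixes w :: "nat \<Rightarrow> 'a::{real_normed_field, banach}"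
  assumes maps: "\<phi> \<in> {1..} \<rightarrow> {1..}" and chaotic: "chaotic (weighted_pseudo_shift w \<phi>)"
  shows "free_injection \<phi>"
proof
  let ?T = "weighted_pseudo_shift w \<phi>"
  obtain f where f: "f \<in> dom_infty ?T" "closure (orbit_of ?T f) = UNIV"
    using chaotic by (auto simp: chaotic_def hypercyclic_def)
  note bl = bounded_linear_coord bounded_linear_sub
    bounded_linear_compose[OF bounded_linear_mult_right bounded_linear_coord]
  have w_nz: "w k \<noteq> 0" if k: "k \<ge> 1" for k
  proof
    assume "w k = 0"
    have "coord x k = 0" for x :: "'a c0"
      by (rule functional_vanishing_on_range_eq_0[OF f(2) bounded_linear_coord])
        (simp add: weighted_pseudo_shift_eq_Some_iff \<open>w k = 0\<close>)
    moreover obtain e :: "'a c0" where "coord e = (\<lambda>l. if l = k then 1 else 0)"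
      using unit_vector_exists k by blast
    ultimately show False by (metis zero_neq_one)
  qed
  show "k \<ge> 1 \<Longrightarrow> \<phi> k \<ge> 1" for k using maps by auto
  show "inj_on \<phi> {1..}"
  proof (rule inj_onI, rule ccontr)
    fix i j assume ij: "i \<in> {1..}" "j \<in> {1..}" "\<phi> i = \<phi> j" "i \<noteq> j"
    have "w j * coord x i - w i * coord x j = 0" for x :: "'a c0"
      by (rule functional_vanishing_on_range_eq_0[OF f(2)], intro bl)
        (simp add: weighted_pseudo_shift_eq_Some_iff ij)
    moreover obtain e :: "'a c0" where "coord e = (\<lambda>l. if l = i then 1 else 0)"
      using unit_vector_exists ij by (metis atLeast_iff)
    ultimately have "w j * 1 - w i * 0 = 0" using ij(4) by metis
    then show False using w_nz ij by simp
  qed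
  show "(\<phi> ^^ n) k \<noteq> k" if n: "n \<ge> 1" and k: "k \<ge> 1" for n k
  proof
    assume fix_k: "(\<phi> ^^ n) k = k"
    let ?a = "forward_prod w \<phi> n k"
    have return: "coord (P (m + n)) k = ?a * coord (P m) k"
      if "\<And>n. ?T (P n) = Some (P (Suc n))" for P m
      using orbit_coord[where P = P and w = w and \<phi> = \<phi>] that fix_k by metis
    obtain N and P :: "nat \<Rightarrow> 'a c0" where P: "coord (P 0) k \<noteq> 0"
      "\<And>n. ?T (P n) = Some (P (Suc n))" "N \<ge> 1" "\<And>n. P (n * N) = P 0"
      using periodic_orbit_charging_coordinate[OF chaotic k] by metis
    \<comment> \<open>At time \<open>N n\<close> both the periodic point and the index \<open>k\<close> have returned.\<close>
    have "coord (P (j * n)) k = ?a ^ j * coord (P 0) k" for j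
      by (induction j) (simp_all add: return[of P, OF P(2)] add.commute[of n])
    then have "?a ^ N = 1" using P(1) P(4)[of n] by (metis mult.commute mult_cancel_right1)
    then have a: "norm ?a = 1" using P(3) by (auto dest: power_eq_1_iff)
    define F where "F m = the (op_pow ?T m f)" for m
    have F: "op_pow ?T m f = Some (F m)" for m
      using f(1) by (cases m) (auto simp: F_def dom_infty_def dom_def simp del: op_pow.simps(2))
    have F_step: "?T (F m) = Some (F (Suc m))" for m
      using F[of m] F[of "Suc m"] by (simp add: map_comp_Some_iff)
    have "norm (coord (F (r + q * n)) k) = norm (coord (F r) k)" for r q
    proof (induction q)
      case (Suc q)
      then show ?case
        using return[of F, OF F_step, of "r + q * n"] a by (simp add: norm_mult ac_simps)
    qed simp
    then have F_mod: "norm (coord (F m) k) = norm (coord (F (m mod n)) k)" for m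
      by (metis mod_div_mult_eq)
    define B where "B = Max ((\<lambda>r. norm (coord (F r) k)) ` {..<n})"
    have "norm (coord (F m) k) \<le> B" for m
      unfolding B_def F_mod[of m] using n by (intro Max_ge) auto
    then have "orbit_of ?T f \<subseteq> {x. norm (coord x k) \<le> B}"
      using F by (auto simp: orbit_of_def)
    moreover have "closed {x :: 'a c0. norm (coord x k) \<le> B}"
      by (intro closed_Collect_le continuous_intros
          bounded_linear.continuous_on[OF bounded_linear_coord])
    ultimately have bound: "norm (coord x k) \<le> B" for x :: "'a c0"
      using f(2) closure_minimal by blast
    obtain e :: "'a c0" where e: "coord e = (\<lambda>l. if l = k then 1 else 0)"
      using unit_vector_exists k by blast
    show False using bound[of "(\<bar>B\<bar> + 1) *\<^sub>R e"] by (simp add: e)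
  qed
qed

lemma finite_range_uniformly_null:
  assumes "finite (range P)" and "e > 0"
  obtains L where "\<And>l m. l \<ge> L \<Longrightarrow> norm (coord (P m) l) < e"
proof -
  have "\<forall>\<^sub>F l in sequentially. norm (coord x l) < e" for x :: "'a c0"
    using tendstoD[OF coord_tendsto_0[of x] \<open>e > 0\<close>] by simp
  then have "\<forall>\<^sub>F l in sequentially. \<forall>x\<in>range P. norm (coord x l) < e"
    using assms(1) by (intro eventually_ball_finite) auto
  then show thesis using that by (auto simp: eventually_sequentially)
qed

context free_injection
begin

lemma eventually_iter_ge:
  assumes "k \<ge> 1"
  shows "\<forall>\<^sub>F n in sequentially. (\<phi> ^^ n) k \<ge> L"
proof -
  have "finite {n. (\<phi> ^^ n) k < L}"
  proof (rule finite_imageD)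
    show "finite ((\<lambda>n. (\<phi> ^^ n) k) ` {n. (\<phi> ^^ n) k < L})"
      by (rule finite_subset[of _ "{..<L}"]) auto
    show "inj_on (\<lambda>n. (\<phi> ^^ n) k) {n. (\<phi> ^^ n) k < L}"
      using iter_index_inj assms by (auto intro: inj_onI)
  qed
  then show ?thesis
    by (simp add: eventually_cofinite not_le flip: cofinite_eq_sequentially)
qed

lemma eventually_preimage_ge:
  "\<forall>\<^sub>F n in sequentially. \<forall>l\<ge>1. (\<phi> ^^ n) l = k \<longrightarrow> l \<ge> L"
proof -
  have "finite {n. (\<phi> ^^ n) l = k}" if "l \<ge> 1" for l
    by (rule finite_imageD[where f = "\<lambda>_. ()"])
      (use iter_index_inj that in \<open>auto simp: inj_on_def\<close>)
  then have "finite (\<Union>l\<in>{1..<L}. {n. (\<phi> ^^ n) l = k})" by auto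
  moreover have "{n. \<not> (\<forall>l\<ge>1. (\<phi> ^^ n) l = k \<longrightarrow> l \<ge> L)} = (\<Union>l\<in>{1..<L}. {n. (\<phi> ^^ n) l = k})"
    by (auto simp: not_le)
  ultimately show ?thesis
    by (simp only: eventually_cofinite flip: cofinite_eq_sequentially)
qed

text \<open>
  The periodic point \<open>p\<close> is reached in \<open>n\<close> steps from the vector \<open>T\<^bsup>nN-n\<^esup> p\<close> of its orbit, \<open>N\<close> being the
  period. That vector is tiny at the far-away index \<open>\<phi>\<^sup>n(k)\<close>, uniformly in \<open>n\<close>, so the product that
  multiplies its coordinate to the fixed value \<open>p\<^sub>k \<noteq> 0\<close> must be huge.
\<close>

lemma chaotic_imp_forward_prod_at_top:
  fixes w :: "nat \<Rightarrow> 'a::{real_normed_field, banach}"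
  assumes "chaotic (weighted_pseudo_shift w \<phi>)" and k: "k \<ge> 1"
  shows "filterlim (\<lambda>n. norm (forward_prod w \<phi> n k)) at_top sequentially"
proof -
  obtain N and P :: "nat \<Rightarrow> 'a c0" where P: "coord (P 0) k \<noteq> 0"
    "\<And>n. weighted_pseudo_shift w \<phi> (P n) = Some (P (Suc n))"
    "N \<ge> 1" "\<And>n. P (n * N) = P 0" "finite (range P)"
    using periodic_orbit_charging_coordinate[OF assms(1) k] by metis
  have "\<forall>\<^sub>F n in sequentially. C \<le> norm (forward_prod w \<phi> n k)" if "C > 0" for C
  proof -
    obtain L where L: "\<And>l m. l \<ge> L \<Longrightarrow> norm (coord (P m) l) < norm (coord (P 0) k) / C"
      using finite_range_uniformly_null[OF P(5), of "norm (coord (P 0) k) / C"] P(1) \<open>C > 0\<close> by auto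
    show ?thesis
      using eventually_iter_ge[OF k, of L]
    proof eventually_elim
      case (elim n)
      have "n \<le> n * N" using P(3) by simp
      then have "coord (P 0) k = forward_prod w \<phi> n k * coord (P (n * N - n)) ((\<phi> ^^ n) k)"
        using orbit_coord[of w \<phi> P "n * N - n" n k] P(2,4) by simp
      then have "norm (coord (P 0) k) =
          norm (forward_prod w \<phi> n k) * norm (coord (P (n * N - n)) ((\<phi> ^^ n) k))"
        by (metis norm_mult)
      also have "\<dots> \<le> norm (forward_prod w \<phi> n k) * (norm (coord (P 0) k) / C)"
        by (intro mult_left_mono[OF less_imp_le[OF L[OF elim]]]) simp
      finally have "norm (coord (P 0) k) * C \<le> norm (forward_prod w \<phi> n k) * norm (coord (P 0) k)"
        using \<open>C > 0\<close> by (simp add: pos_le_divide_eq)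
      then show ?case using P(1) by (simp add: mult.commute)
    qed
  qed
  then show ?thesis
    by (auto simp: filterlim_at_top_gt[where c = 0])
qed

text \<open>
  When \<open>k\<close> has an \<open>n\<close>-th preimage \<open>l\<close>, the backward product is the factor by which \<open>p\<^sub>k\<close> enters the
  coordinate of \<open>T\<^sup>n p\<close> at \<open>l\<close>, and \<open>l\<close> is far away for large \<open>n\<close>; otherwise the product is zero by the
  convention \<open>w\<^sub>0 = 0\<close>.
\<close>

lemma chaotic_imp_backward_prod_null:
  fixes w :: "nat \<Rightarrow> 'a::{real_normed_field, banach}"
  assumes "chaotic (weighted_pseudo_shift w \<phi>)" and k: "k \<ge> 1" and w0: "w 0 = 0"
  shows "(\<lambda>n. norm (backward_prod w \<phi> n k)) \<longlonglongrightarrow> 0"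
proof (rule tendstoI)
  fix e :: real assume e: "e > 0"
  obtain N and P :: "nat \<Rightarrow> 'a c0" where P: "coord (P 0) k \<noteq> 0"
    "\<And>n. weighted_pseudo_shift w \<phi> (P n) = Some (P (Suc n))"
    "N \<ge> 1" "\<And>n. P (n * N) = P 0" "finite (range P)"
    using periodic_orbit_charging_coordinate[OF assms(1) k] by metis
  obtain L where L: "\<And>l m. l \<ge> L \<Longrightarrow> norm (coord (P m) l) < e * norm (coord (P 0) k)"
    using finite_range_uniformly_null[OF P(5), of "e * norm (coord (P 0) k)"] P(1) e by auto
  show "\<forall>\<^sub>F n in sequentially. dist (norm (backward_prod w \<phi> n k)) 0 < e"
    using eventually_preimage_ge[of k L]
  proof eventually_elim
    case (elim n)
    show ?case
    proof (cases "\<exists>l\<ge>1. (\<phi> ^^ n) l = k")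
      case True
      then obtain l where l: "l \<ge> 1" "(\<phi> ^^ n) l = k" by blast
      have "norm (forward_prod w \<phi> n l) * norm (coord (P 0) k) = norm (coord (P n) l)"
        using orbit_coord[of w \<phi> P 0 n l] P(2) l by (simp add: norm_mult)
      also have "\<dots> < e * norm (coord (P 0) k)" using L elim l by blast
      finally show ?thesis using P(1) backward_prod_preimage[OF l(2,1), of w] by simp
    next
      case False
      then show ?thesis using backward_prod_no_preimage[of n k w] k w0 e by auto
    qed
  qed
qed

end

section \<open>Sufficiency\<close>

locale expanding_weights = free_injection \<phi> for \<phi> +
  fixes w :: "nat \<Rightarrow> 'a::{real_normed_field, banach}"
  assumes w_0: "w 0 = 0"
    and forward: "k \<ge> 1 \<Longrightarrow> filterlim (\<lambda>n. norm (forward_prod w \<phi> n k)) at_top sequentially"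
    and backward: "k \<ge> 1 \<Longrightarrow> (\<lambda>n. norm (backward_prod w \<phi> n k)) \<longlonglongrightarrow> 0"
begin

lemma forward_prod_nonzero:
  assumes "k \<ge> 1"
  shows "forward_prod w \<phi> n k \<noteq> 0"
proof -
  have "\<forall>\<^sub>F m in sequentially. norm (forward_prod w \<phi> m k) > 0"
    using forward[OF assms] by (simp only: filterlim_at_top_dense)
  then obtain M where "\<And>m. m \<ge> M \<Longrightarrow> norm (forward_prod w \<phi> m k) > 0"
    by (auto simp: eventually_sequentially)
  from this[of "n + M"] show ?thesis by (auto simp: forward_prod_add)
qed

text \<open>
  The solution \<open>u\<close> of \<open>w\<^sub>l u\<^bsub>\<phi>(l)\<^esub> = u\<^sub>l\<close>, \<open>u\<^sub>k = 1\<close>, on the two-sided orbit of \<open>k\<close>. Comparing the two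
  products up to a common later point covers both directions of the orbit by one formula; the choice
  is harmless since the quotient is the same for every common later point.
\<close>

definition orbit_coeff :: "nat \<Rightarrow> nat \<Rightarrow> 'a" where
  "orbit_coeff k l = (SOME c. \<exists>m n. (\<phi> ^^ m) l = (\<phi> ^^ n) k \<and>
     c = forward_prod w \<phi> m l / forward_prod w \<phi> n k)"

lemma orbit_coeff_eq:
  assumes "(\<phi> ^^ m) l = (\<phi> ^^ n) k" and kl: "k \<ge> 1" "l \<ge> 1"
  shows "orbit_coeff k l = forward_prod w \<phi> m l / forward_prod w \<phi> n k"
proof -
  have indep: "forward_prod w \<phi> m l / forward_prod w \<phi> n k =
      forward_prod w \<phi> m' l / forward_prod w \<phi> n' k"
    if eqs: "(\<phi> ^^ m) l = (\<phi> ^^ n) k" "(\<phi> ^^ m') l = (\<phi> ^^ n') k" and le: "m \<le> m'"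
    for m n m' n'
  proof -
    obtain d where d: "m' = m + d" using le le_Suc_ex by blast
    have "int m - int n = int m' - int n'"
      using eqs kl by (intro hits_time_unique[of k l]) (auto simp: hits_def)
    then have "n' = n + d" using d by simp
    moreover have "forward_prod w \<phi> d ((\<phi> ^^ n) k) \<noteq> 0"
      using forward_prod_nonzero iter_pos kl by blast
    ultimately show ?thesis by (simp add: d forward_prod_add eqs(1))
  qed
  have "\<exists>m n. (\<phi> ^^ m) l = (\<phi> ^^ n) k \<and>
      orbit_coeff k l = forward_prod w \<phi> m l / forward_prod w \<phi> n k"
    unfolding orbit_coeff_def by (rule someI_ex) (use assms(1) in blast)
  then obtain m' n' where "(\<phi> ^^ m') l = (\<phi> ^^ n') k"
    "orbit_coeff k l = forward_prod w \<phi> m' l / forward_prod w \<phi> n' k" by blast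
  then show ?thesis
    using indep[OF assms(1), of m' n'] indep[of m' n' m n] assms(1) by (metis nle_le)
qed

lemma orbit_coeff_step:
  assumes "hits k (\<phi> l) s" "k \<ge> 1" "l \<ge> 1"
  shows "w l * orbit_coeff k (\<phi> l) = orbit_coeff k l"
proof -
  obtain m n where mn: "(\<phi> ^^ m) (\<phi> l) = (\<phi> ^^ n) k" using assms by (auto simp: hits_def)
  then have "(\<phi> ^^ (1 + m)) l = (\<phi> ^^ n) k" by (simp add: funpow_swap1)
  then have "orbit_coeff k l = forward_prod w \<phi> (1 + m) l / forward_prod w \<phi> n k"
    using assms by (intro orbit_coeff_eq)
  moreover have "orbit_coeff k (\<phi> l) = forward_prod w \<phi> m (\<phi> l) / forward_prod w \<phi> n k"
    using assms maps mn by (intro orbit_coeff_eq)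
  ultimately show ?thesis
    unfolding forward_prod_add by (simp add: forward_prod_def)
qed

text \<open>
  At the preimages of \<open>k\<close> the coefficient is a backward product, at the images of \<open>k\<close> it is the
  reciprocal of a forward product.
\<close>

lemma orbit_coeff_small:
  assumes "k \<ge> 1" "e > 0"
  shows "\<exists>S. \<forall>l s. hits k l s \<longrightarrow> \<bar>s\<bar> \<ge> S \<longrightarrow> norm (orbit_coeff k l) \<le> e"
proof -
  have "\<forall>\<^sub>F n in sequentially. 1 / e \<le> norm (forward_prod w \<phi> n k)"
    using forward[OF assms(1)] by (simp add: filterlim_at_top)
  moreover have "\<forall>\<^sub>F n in sequentially. norm (backward_prod w \<phi> n k) < e"
    using order_tendstoD(2)[OF backward] assms by blast
  ultimately obtain S where S:
    "\<And>n. n \<ge> S \<Longrightarrow> 1 / e \<le> norm (forward_prod w \<phi> n k)"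
    "\<And>n. n \<ge> S \<Longrightarrow> norm (backward_prod w \<phi> n k) < e"
    unfolding eventually_sequentially by (metis max.bounded_iff)
  have "norm (orbit_coeff k l) \<le> e" if l: "hits k l s" and s: "\<bar>s\<bar> \<ge> int S" for l s
  proof (cases s rule: int_cases2)
    case (nonneg n)
    have "l \<ge> 1" using l by (simp add: hits_def)
    moreover have n: "(\<phi> ^^ n) l = k" using hits_nonneg l nonneg assms by blast
    ultimately have "orbit_coeff k l = backward_prod w \<phi> n k"
      using orbit_coeff_eq[of n l 0 k] backward_prod_preimage[of n l k w] assms
      by (simp add: forward_prod_def)
    then show ?thesis using S(2)[of n] s nonneg by simp
  next
    case (nonpos n)
    have "l \<ge> 1" using l by (simp add: hits_def)
    moreover have n: "l = (\<phi> ^^ n) k" using hits_nonpos l nonpos assms by blast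
    ultimately have "norm (orbit_coeff k l) = 1 / norm (forward_prod w \<phi> n k)"
      using orbit_coeff_eq[of 0 l n k] assms
      by (simp add: forward_prod_def norm_divide)
    also have "\<dots> \<le> 1 / (1 / e)"
      using S(1)[of n] s nonpos assms by (intro divide_left_mono mult_pos_pos) (auto intro: less_le_trans[rotated])
    finally show ?thesis by simp
  qed
  then show ?thesis by blast
qed

definition orbit_fun :: "nat \<Rightarrow> int set \<Rightarrow> nat \<Rightarrow> 'a" where
  "orbit_fun k A l = (if \<exists>s\<in>A. hits k l s then orbit_coeff k l else 0)"

lemma orbit_fun_0 [simp]: "orbit_fun k A 0 = 0"
  by (simp add: orbit_fun_def hits_def)

lemma orbit_fun_shift:
  assumes "k \<ge> 1"
  shows "w l * orbit_fun k A (\<phi> l) = orbit_fun k ((\<lambda>s. s + 1) ` A) l"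
proof (cases "l \<ge> 1")
  case True
  then show ?thesis
    using orbit_coeff_step[OF _ assms True] hits_step[OF True, of k] by (auto simp: orbit_fun_def)
next
  case False
  then have "l = 0" by simp
  then show ?thesis by (simp add: w_0)
qed

lemma orbit_fun_single_0:
  assumes "k \<ge> 1"
  shows "orbit_fun k {0} l = (if l = k then 1 else 0)"
  using assms orbit_coeff_eq[of 0 k 0 k] by (simp add: orbit_fun_def hits_0 forward_prod_def)

text \<open>
  Coefficients of modulus at least \<open>e\<close> occur only at bounded times, and each time belongs to at most
  one point. This is where injectivity of \<open>\<phi>\<close> puts the vector into \<open>c\<^sub>0\<close>.
\<close>

lemma orbit_fun_null:
  assumes "k \<ge> 1"
  shows "orbit_fun k A \<longlonglongrightarrow> 0"
proof (rule tendstoI)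
  fix e :: real assume "e > 0"
  then obtain S where S: "\<And>l s. hits k l s \<Longrightarrow> \<bar>s\<bar> \<ge> S \<Longrightarrow> norm (orbit_coeff k l) \<le> e / 2"
    using orbit_coeff_small[OF assms, of "e / 2"] by auto
  have "{l. \<not> dist (orbit_fun k A l) 0 < e} \<subseteq> (\<Union>s\<in>{-S..S}. {l. hits k l s})"
  proof
    fix l assume "l \<in> {l. \<not> dist (orbit_fun k A l) 0 < e}"
    then have "norm (orbit_fun k A l) \<ge> e" by simp
    then obtain s where s: "hits k l s" "norm (orbit_coeff k l) \<ge> e"
      using \<open>e > 0\<close> by (auto simp: orbit_fun_def split: if_splits)
    then have "\<not> \<bar>s\<bar> \<ge> S" using S[of l s] \<open>e > 0\<close> by auto
    then show "l \<in> (\<Union>s\<in>{-S..S}. {l. hits k l s})" using s by (intro UN_I[of s]) auto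
  qed
  moreover have "finite {l. hits k l s}" for s
    by (rule finite_imageD[where f = "\<lambda>_. ()"])
      (use hits_source_unique in \<open>auto simp: inj_on_def\<close>)
  ultimately have "finite {l. \<not> dist (orbit_fun k A l) 0 < e}"
    by (meson finite_UN_I finite_atLeastAtMost_int finite_subset)
  then show "\<forall>\<^sub>F l in sequentially. dist (orbit_fun k A l) 0 < e"
    by (simp only: eventually_cofinite flip: cofinite_eq_sequentially)
qed

definition orbit_sum :: "(nat \<Rightarrow> 'a) \<Rightarrow> nat \<Rightarrow> int set \<Rightarrow> 'a c0" where
  "orbit_sum a K A = Abs_c0 (\<lambda>l. \<Sum>k=1..K. a k * orbit_fun k A l)"

lemma coord_orbit_sum: "coord (orbit_sum a K A) l = (\<Sum>k=1..K. a k * orbit_fun k A l)"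
proof -
  have "(\<lambda>l. \<Sum>k=1..K. a k * orbit_fun k A l) \<longlonglongrightarrow> (\<Sum>k=1..K. a k * 0)"
    by (intro tendsto_sum tendsto_mult tendsto_const orbit_fun_null) auto
  then show ?thesis
    unfolding orbit_sum_def by (subst Abs_c0_inverse) (auto simp: null_seqs_def)
qed

lemma pseudo_shift_orbit_sum:
  "weighted_pseudo_shift w \<phi> (orbit_sum a K A) = Some (orbit_sum a K ((\<lambda>s. s + 1) ` A))"
  unfolding weighted_pseudo_shift_eq_Some_iff coord_orbit_sum sum_distrib_left
  by (auto simp: orbit_fun_shift[symmetric] mult.left_commute intro!: sum.cong)

text \<open>
  One estimate that provides both decay of the two-sided orbits \<open>n \<mapsto> orbit_sum a K {n}\<close> and closeness
  of the periodic vectors to finite sequences.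
\<close>

lemma orbit_sum_small:
  assumes "e > 0"
  shows "\<exists>S. \<forall>A. (\<forall>s\<in>A. \<bar>s\<bar> \<ge> S) \<longrightarrow> norm (orbit_sum a K A) \<le> e"
proof -
  define c where "c = (\<Sum>k=1..K. norm (a k)) + 1"
  have c: "c > 0" unfolding c_def by (simp add: add_nonneg_pos sum_nonneg)
  have "\<exists>S. \<forall>k\<in>{1..K}. \<forall>l s. hits k l s \<longrightarrow> \<bar>s\<bar> \<ge> S \<longrightarrow> norm (orbit_coeff k l) \<le> e / c"
  proof -
    have "\<exists>S. \<forall>l s. hits k l s \<longrightarrow> \<bar>s\<bar> \<ge> S \<longrightarrow> norm (orbit_coeff k l) \<le> e / c" if "k \<ge> 1" for k
      using orbit_coeff_small that assms c by simp
    then obtain S where S: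
      "\<And>k l s. k \<ge> 1 \<Longrightarrow> hits k l s \<Longrightarrow> \<bar>s\<bar> \<ge> S k \<Longrightarrow> norm (orbit_coeff k l) \<le> e / c"
      by metis
    have "S k \<le> Max (S ` {1..K})" if "k \<in> {1..K}" for k using that by (intro Max_ge) auto
    with S show ?thesis by (meson atLeastAtMost_iff order_trans)
  qed
  then obtain S where S:
    "\<And>k l s. k \<in> {1..K} \<Longrightarrow> hits k l s \<Longrightarrow> \<bar>s\<bar> \<ge> S \<Longrightarrow> norm (orbit_coeff k l) \<le> e / c"
    by blast
  have "norm (orbit_sum a K A) \<le> e" if A: "\<forall>s\<in>A. \<bar>s\<bar> \<ge> S" for A
  proof (rule norm_c0_le)
    fix l
    have "norm (orbit_fun k A l) \<le> e / c" if "k \<in> {1..K}" for k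
      using S[OF that, of l] A assms c by (auto simp: orbit_fun_def)
    then have "norm (coord (orbit_sum a K A) l) \<le> (\<Sum>k=1..K. norm (a k) * (e / c))"
      unfolding coord_orbit_sum
      by (intro sum_norm_le) (simp only: norm_mult mult_left_mono norm_ge_zero)
    also have "\<dots> = (\<Sum>k=1..K. norm (a k)) * (e / c)" by (rule sum_distrib_right[symmetric])
    also have "\<dots> = (c - 1) * (e / c)" by (simp add: c_def)
    also have "\<dots> \<le> e" using assms c by (simp add: field_simps)
    finally show "norm (coord (orbit_sum a K A) l) \<le> e" .
  qed
  then show ?thesis by blast
qed

lemma norm_diff_truncation:
  assumes "\<And>k. 1 \<le> k \<Longrightarrow> k \<le> K \<Longrightarrow> norm (a k - coord x k) \<le> e"
    and "\<And>l. l > K \<Longrightarrow> norm (coord x l) \<le> e" and "e > 0"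
  shows "norm (orbit_sum a K {0} - x) \<le> e"
proof (rule norm_c0_le)
  fix l
  have "coord (orbit_sum a K {0}) l = (\<Sum>k=1..K. if k = l then a l else 0)"
    unfolding coord_orbit_sum by (rule sum.cong) (auto simp: orbit_fun_single_0)
  also have "\<dots> = (if 1 \<le> l \<and> l \<le> K then a l else 0)" by (simp add: sum.delta)
  finally show "norm (coord (orbit_sum a K {0} - x) l) \<le> e"
    using assms by (cases "l = 0") (auto simp: not_le)
qed

lemma coord_eventually_small:
  assumes "e > 0"
  obtains K where "\<And>l. l > K \<Longrightarrow> norm (coord x l) \<le> e"
  using tendstoD[OF coord_tendsto_0[of x] assms]
  by (force simp: eventually_sequentially dest: less_imp_le)

text \<open>
  Truncate \<open>x\<close> to a finite sequence, the restriction to time 0, and spread it to all times in \<open>N\<int>\<close>.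
  This set of times is invariant under translation by \<open>N\<close>, and for large \<open>N\<close> its nonzero elements
  contribute little.
\<close>

lemma periodic_points_dense: "closure (periodic_points (weighted_pseudo_shift w \<phi>)) = UNIV"
proof -
  have "\<exists>p\<in>periodic_points (weighted_pseudo_shift w \<phi>). dist p x < e" if "e > 0" for x e
  proof -
    obtain K where K: "\<And>l. l > K \<Longrightarrow> norm (coord x l) \<le> e / 4"
      using coord_eventually_small[of "e / 4" x] \<open>e > 0\<close> by auto
    let ?s = "orbit_sum (coord x) K"
    have trunc: "norm (?s {0} - x) \<le> e / 4"
      using K \<open>e > 0\<close> by (intro norm_diff_truncation) auto
    obtain S where S: "\<And>A. \<forall>s\<in>A. \<bar>s\<bar> \<ge> S \<Longrightarrow> norm (?s A) \<le> e / 4"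
      using orbit_sum_small[of "e / 4"] \<open>e > 0\<close> by (metis divide_pos_pos zero_less_numeral)
    define N where "N = nat \<bar>S\<bar> + 1"
    let ?A = "{s. int N dvd s}"
    have "N \<ge> 1" by (simp add: N_def)
    have "op_pow (weighted_pseudo_shift w \<phi>) n (?s ?A) = Some (?s ((\<lambda>s. s + int n) ` ?A))" for n
    proof (induction n)
      case (Suc n)
      then show ?case by (simp add: pseudo_shift_orbit_sum image_image algebra_simps)
    qed simp
    moreover have "(\<lambda>s. s + int N) ` ?A = ?A"
      by (auto intro!: image_eqI[of s _ "s - int N" for s])
    ultimately have "?s ?A \<in> periodic_points (weighted_pseudo_shift w \<phi>)"
      using \<open>N \<ge> 1\<close> unfolding periodic_points_def by (metis (mono_tags, lifting) mem_Collect_eq)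
    moreover have "dist (?s ?A) x < e"
    proof -
      have "?s ?A = ?s {0} + ?s (?A - {0})"
      proof (rule c0_eqI)
        fix l
        have "orbit_fun k ?A l = orbit_fun k {0} l + orbit_fun k (?A - {0}) l" if "k \<ge> 1" for k
          using hits_time_unique[of k l 0] that by (auto simp: orbit_fun_def)
        then show "coord (?s ?A) l = coord (?s {0} + ?s (?A - {0})) l"
          by (simp add: coord_orbit_sum distrib_left flip: sum.distrib)
      qed
      moreover have "norm (?s (?A - {0})) \<le> e / 4"
      proof (rule S, rule ballI)
        fix s assume "s \<in> ?A - {0}"
        then have "int N \<le> \<bar>s\<bar>" using dvd_imp_le_int[of s "int N"] by simp
        then show "S \<le> \<bar>s\<bar>" by (simp add: N_def)
      qed
      moreover from calculation(1) have "?s ?A - x = (?s {0} - x) + ?s (?A - {0})"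
        by (simp only: diff_add_eq)
      ultimately have "norm (?s ?A - x) \<le> e / 4 + e / 4"
        using norm_triangle_mono[OF trunc] by (simp only:)
      then show ?thesis using \<open>e > 0\<close> by (simp add: dist_norm)
    qed
    ultimately show ?thesis by blast
  qed
  then show ?thesis by (auto simp: closure_approachable)
qed

text \<open>
  The dense sequence consists of the finite sequences with coordinates in a countable dense set of
  scalars, encoded as lists of indices into that set.
\<close>

lemma hypercyclic:
  fixes q :: "nat \<Rightarrow> 'a"
  assumes q: "closure (range q) = UNIV"
  shows "hypercyclic (weighted_pseudo_shift w \<phi>)"
proof -
  \<comment> \<open>Indices of coordinates start at 1, so the head of the list is a dummy entry.\<close>
  define V where "V i n =
    (let js = from_nat i :: nat list in orbit_sum (\<lambda>k. q (js ! k)) (length js - 1) {n})" for i n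
  show ?thesis
  proof (rule hypercyclic_if_two_sided_orbits[where V = V])
    show "weighted_pseudo_shift w \<phi> (V i n) = Some (V i (n + 1))" for i n
      by (simp add: V_def Let_def pseudo_shift_orbit_sum)
    show "\<exists>M. \<forall>n. \<bar>n\<bar> \<ge> M \<longrightarrow> norm (V i n) \<le> e" if "e > 0" for i e
      using orbit_sum_small[OF that] unfolding V_def Let_def by (metis singletonD)
    have "\<exists>i. dist (V i 0) x < e" if "e > 0" for x e
    proof -
      obtain K where K: "\<And>l. l > K \<Longrightarrow> norm (coord x l) \<le> e / 2"
        using coord_eventually_small[of "e / 2" x] \<open>e > 0\<close> by auto
      have "\<exists>j. norm (q j - coord x k) < e / 2" for k
      proof -
        have "coord x k \<in> closure (range q)" by (simp add: q)
        then show ?thesis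
          using \<open>e > 0\<close> unfolding closure_approachable by (metis dist_norm half_gt_zero imageE)
      qed
      then obtain j where j: "\<And>k. norm (q (j k) - coord x k) < e / 2" by metis
      let ?js = "map j [0..<Suc K]"
      have "norm (V (to_nat ?js) 0 - x) \<le> e / 2"
        unfolding V_def Let_def from_nat_to_nat
      proof (rule norm_diff_truncation)
        show "norm (q (?js ! k) - coord x k) \<le> e / 2" if "1 \<le> k" "k \<le> length ?js - 1" for k
          using j[of k] that by (simp del: upt_Suc)
      qed (use K \<open>e > 0\<close> in auto)
      then show ?thesis
        using \<open>e > 0\<close> by (intro exI[of _ "to_nat ?js"]) (simp add: dist_norm)
    qed
    then show "closure (range (\<lambda>i. V i 0)) = UNIV"
      by (auto simp: closure_approachable)
  qed (rule closed_graph_weighted_pseudo_shift subspace_graph_weighted_pseudo_shift)+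
qed

end

theorem theorem3p17:
  fixes \<phi> :: "nat \<Rightarrow> nat"
    and w :: "nat \<Rightarrow> 'a::{real_normed_field, euclidean_space}"
  assumes "\<phi> \<in> {1..} \<rightarrow> {1..}"
    and "w 0 = 0"
    and "\<not> bounded_everywhere (weighted_pseudo_shift w \<phi>)"
  shows "chaotic (weighted_pseudo_shift w \<phi>) \<longleftrightarrow>
    inj_on \<phi> {1..} \<and>
    (\<forall>n\<ge>1. \<forall>k\<ge>1. (\<phi> ^^ n) k \<noteq> k) \<and>
    (\<forall>k\<ge>1.
      filterlim (\<lambda>n. norm (forward_prod w \<phi> n k)) at_top sequentially \<and>
      (\<lambda>n. norm (backward_prod w \<phi> n k)) \<longlonglongrightarrow> 0)"
    (is "_ \<longleftrightarrow> ?conditions")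
proof
  assume chaotic: "chaotic (weighted_pseudo_shift w \<phi>)"
  then interpret free_injection \<phi>
    using chaotic_imp_free_injection assms(1) by blast
  show ?conditions
    using inj no_cycle chaotic_imp_forward_prod_at_top[OF chaotic]
      chaotic_imp_backward_prod_null[OF chaotic _ assms(2)] by blast
next
  assume ?conditions
  then interpret expanding_weights \<phi> w
    by unfold_locales (use assms(1,2) in auto)
  obtain D :: "'a set" where D: "countable D" "\<And>X. open X \<Longrightarrow> X \<noteq> {} \<Longrightarrow> \<exists>d\<in>D. d \<in> X"
    using countable_dense_exists by metis
  have "D \<noteq> {}" using D(2)[of UNIV] by auto
  then have "range (from_nat_into D) = D" using D(1) by simp
  moreover have "closure D = UNIV"
    unfolding closure_approachable set_eq_iff using D(2)[of "ball _ _"] by (auto simp: dist_commute)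
  ultimately show "chaotic (weighted_pseudo_shift w \<phi>)"
    using hypercyclic[of "from_nat_into D"] periodic_points_dense by (simp add: chaotic_def)
qed

end
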